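(* Suppose that each $Q^{(i)}$ ($i\in\mathcal I$) is quasi-firmly nonexpansive, each $f^{(i)}$ ($i\in\mathcal I$) is continuous and convex, and $X^\star\neq\emptyset$. Let $(x_n)_{n\in\mathbb N}$ be generated by the parallel subgradient method with constant step size $\lambda_n:=\lambda\in(0,\infty)$ ($n\in\mathbb N$). Suppose that for every $i\in\mathcal I$ there are $M_1^{(i)},M_2^{(i)}\in\mathbb R$ such that $$\sup\{\|g\|: g\in\partial f^{(i)}(Q_\alpha^{(i)}(x_n)),\ n\in\mathbb N\}\le M_1^{(i)},\qquad \sup\{\|g\|: g\in\partial f^{(i)}(x_n),\ n\in\mathbb N\}\le M_2^{(i)},$$ and put $M_1:=\max_{i\in\mathcal I}(M_1^{(i)})^2$ and $M_2:=\max_{i\in\mathcal I}M_2^{(i)}$. Fix some $x\in X$ and put $$M_\lambda:=\sup_{n\in\mathbb N}\Big(M_1\lambda+\frac1I\Big|\sum_{i\in\mathcal I}\langle x-x_n,g_n^{(i)}\rangle\Big|\Big)\in[0,\infty].$$ Then $$\liminf_{n\to\infty}\|x_n-Q^{(i)}(x_n)\|^2\le\frac{I M_\lambda\lambda}{\alpha^{(i)}(1-\alpha^{(i)})}\qquad(i\in\mathcal I),$$ $$\liminf_{n\to\infty}f(x_n)\le f^\star+I M_1\lambda+\big(\sqrt{M_1}+M_2\big)\sum_{i\in\mathcal I}\sqrt{\frac{(1-\alpha^{(i)})\,I M_\lambda\lambda}{\alpha^{(i)}}}.$$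
   Context: $H$ is a real Hilbert space with inner product $\langle\cdot,\cdot\rangle$ and norm $\|\cdot\|$; $\mathrm{Id}$ is the identity on $H$; $\mathbb N=\{0,1,2,\dots\}$. For $Q:H\to H$, $\mathrm{Fix}(Q)=\{x\in H: Q(x)=x\}$. $Q$ is quasi-firmly nonexpansive if $\|Q(x)-y\|^2+\|(\mathrm{Id}-Q)(x)\|^2\le\|x-y\|^2$ for all $x\in H$, $y\in\mathrm{Fix}(Q)$. The subdifferential of $f:H\to\mathbb R$ at $x$ is $\partial f(x)=\{u\in H: f(y)\ge f(x)+\langle y-x,u\rangle\ \forall y\in H\}$. Setting: $I\ge1$ is an integer (number of users), $\mathcal I=\{1,\dots,I\}$; for $i\in\mathcal I$, $f^{(i)}:H\to\mathbb R$, $Q^{(i)}:H\to H$, $\alpha^{(i)}\in(0,1)$, $Q_\alpha^{(i)}:=\alpha^{(i)}\mathrm{Id}+(1-\alpha^{(i)})Q^{(i)}$. Put $X:=\bigcap_{i\in\mathcal I}\mathrm{Fix}(Q^{(i)})$, $f:=\sum_{i\in\mathcal I}f^{(i)}$, $f^\star:=\inf_{y\in X}f(y)$, $X^\star:=\{x\in X: f(x)=f^\star\}$. (Operationally, user $i$ can use $Q^{(i)}$ and $\partial f^{(i)}$, and each user can communicate with the others, so that the method can be run.) Parallel subgradient method: given $x_0\in H$ and $(\lambda_n)_{n\in\mathbb N}\subset(0,\infty)$, for every $n\in\mathbb N$, $$x_n^{(i)}:=Q_\alpha^{(i)}(x_n)-\lambda_n g_n^{(i)},\quad g_n^{(i)}\in\partial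 f^{(i)}(Q_\alpha^{(i)}(x_n))\quad(i\in\mathcal I),\qquad x_{n+1}:=\frac1I\sum_{i\in\mathcal I}x_n^{(i)}.$$ If $M_\lambda=\infty$, the right-hand sides of the bounds are understood as $+\infty$. *)

theory Defs
  imports "HOL-Analysis.Analysis"
begin

text \<open>Real Hilbert spaces are types of sort \<open>{real_inner, complete_space}\<close>;
  the users are the natural numbers in \<open>{1..I}\<close>.\<close>

definition Fix :: "('a \<Rightarrow> 'a) \<Rightarrow> 'a set" where
  "Fix Q = {x. Q x = x}"

definition quasi_firmly_nonexpansive :: "('a::real_inner \<Rightarrow> 'a) \<Rightarrow> bool" where
  "quasi_firmly_nonexpansive Q \<longleftrightarrow>
     (\<forall>x. \<forall>y \<in> Fix Q. (norm (Q x - y))\<^sup>2 + (norm (x - Q x))\<^sup>2 \<le> (norm (x - y))\<^sup>2)"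

definition subdifferential :: "('a::real_inner \<Rightarrow> real) \<Rightarrow> 'a \<Rightarrow> 'a set" where
  "subdifferential f x = {u. \<forall>y. f y \<ge> f x + (y - x) \<bullet> u}"

definition averaged_map :: "real \<Rightarrow> ('a::real_vector \<Rightarrow> 'a) \<Rightarrow> 'a \<Rightarrow> 'a" where
  "averaged_map a Q x = a *\<^sub>R x + (1 - a) *\<^sub>R Q x"

definition constraint_set :: "nat \<Rightarrow> (nat \<Rightarrow> 'a \<Rightarrow> 'a) \<Rightarrow> 'a set" where
  "constraint_set I Q = (\<Inter>i\<in>{1..I}. Fix (Q i))"

definition total_objective :: "nat \<Rightarrow> (nat \<Rightarrow> 'a \<Rightarrow> real) \<Rightarrow> 'a \<Rightarrow> real" where
  "total_objective I f x = (\<Sum>i\<in>{1..I}. f i x)"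

text \<open>The infimum is taken in the extended reals, so that it is meaningful also when the
  objective is unbounded below on the constraint set or the constraint set is empty.\<close>

definition optimal_value ::
    "nat \<Rightarrow> (nat \<Rightarrow> 'a \<Rightarrow> real) \<Rightarrow> (nat \<Rightarrow> 'a \<Rightarrow> 'a) \<Rightarrow> ereal" where
  "optimal_value I f Q = (INF y\<in>constraint_set I Q. ereal (total_objective I f y))"

definition solution_set ::
    "nat \<Rightarrow> (nat \<Rightarrow> 'a \<Rightarrow> real) \<Rightarrow> (nat \<Rightarrow> 'a \<Rightarrow> 'a) \<Rightarrow> 'a set" where
  "solution_set I f Q =
     {x \<in> constraint_set I Q. ereal (total_objective I f x) = optimal_value I f Q}"

text \<open>\<open>g i n\<close> is the subgradient chosen by user \<open>i\<close> in iteration \<open>n\<close>; the initial point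
  \<open>x 0\<close> is arbitrary.\<close>

definition parallel_subgradient_method ::
    "nat \<Rightarrow> (nat \<Rightarrow> 'a::real_inner \<Rightarrow> real) \<Rightarrow> (nat \<Rightarrow> 'a \<Rightarrow> 'a) \<Rightarrow> (nat \<Rightarrow> real) \<Rightarrow>
     (nat \<Rightarrow> real) \<Rightarrow> (nat \<Rightarrow> 'a) \<Rightarrow> (nat \<Rightarrow> nat \<Rightarrow> 'a) \<Rightarrow> bool" where
  "parallel_subgradient_method I f Q \<alpha> lam x g \<longleftrightarrow>
     (\<forall>n. 0 < lam n) \<and>
     (\<forall>n. \<forall>i\<in>{1..I}. g i n \<in> subdifferential (f i) (averaged_map (\<alpha> i) (Q i) (x n))) \<and>
     (\<forall>n. x (Suc n) =
        (1 / real I) *\<^sub>R (\<Sum>i\<in>{1..I}. averaged_map (\<alpha> i) (Q i) (x n) - lam n *\<^sub>R g i n))"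

end

theory Submission
  imports Defs
begin

text \<open>
  Both bounds come from one principle (\<open>liminf_le_of_bounded_increase\<close>): if a nonnegative quantity
  grows in each step by at most a positive multiple of \<open>c - h n\<close>, the lower limit of \<open>h\<close> is at
  most \<open>c\<close>. Write \<open>r i n\<close> for the residual \<open>norm (x n - Q i (x n))\<close> and \<open>D n\<close> for the sum over the
  users of \<open>\<alpha> i * (1 - \<alpha> i) * (r i n)\<^sup>2\<close>.

  For the residuals the quantity is the squared distance to the fixed feasible point \<open>z\<close>. Expanding
  a step (\<open>fixed_point_residual_step\<close>) and averaging over the users shows that it grows by at most
  \<open>2 / I * (I * M_lam * lam - D n)\<close>, and each weighted squared residual is at most \<open>D n\<close>.

  For the objective, the squared distance to a minimizer \<open>y\<close> alone is not enough. The subgradient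
  inequalities (\<open>objective_step\<close>) control \<open>f (x n) - f y\<close> only up to \<open>M2\<close> times the displacements
  \<open>(1 - \<alpha> i) * r i n\<close>, and the residual bounds just described hold along subsequences that may
  differ from user to user and from a subsequence on which the objective is small. Therefore both
  distances are combined into \<open>(norm (x n - y))\<^sup>2 + \<theta> * (norm (x n - z))\<^sup>2\<close>. By the inequality of
  arithmetic and geometric means (\<open>displacement_le_weighted_residual\<close>) the displacements are at most
  affine in \<open>D n\<close>, and a suitable \<open>\<theta>\<close> cancels \<open>D n\<close> altogether; what remains is the square-root
  term of the claim.

  The bound \<open>M2\<close> speaks about subgradients at \<open>x n\<close>, so it has content only if there are any. That a
  continuous convex function on a Hilbert space has subgradients everywhere
  (\<open>subdifferential_nonempty\<close>) is proved without the Hahn-Banach theorem, from the fact that a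
  decreasing sequence of nonempty bounded closed convex sets has a common point.
\<close>

section \<open>Subgradients of continuous convex functions on a Hilbert space\<close>

lemma infdist_approached:
  assumes "A \<noteq> {}" and "0 < e"
  shows "\<exists>a\<in>A. dist x a < infdist x A + e"
proof -
  have "bdd_below (dist x ` A)" by (rule bdd_belowI2[of _ 0]) simp
  moreover have "(INF a\<in>A. dist x a) < infdist x A + e"
    using assms by (simp add: infdist_notempty)
  ultimately show ?thesis using cINF_less_iff[OF assms(1)] by blast
qed

text \<open>In a Hilbert space this replaces compactness. Choose nearly norm-minimal points of the sets.
  Their norms converge, because the minimal norms increase and are bounded; the midpoint of two
  of them lies in the larger set, so the parallelogram identity makes their distance small.
  Both the projection theorem and the existence of subgradients are instances.\<close>

lemma nested_closed_convex_sets_meet: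
  fixes C :: "nat \<Rightarrow> 'a::{real_inner, complete_space} set"
  assumes dec: "decseq C" and bdd: "bounded (C 0)"
    and cl: "\<And>n. closed (C n)" and conv: "\<And>n. convex (C n)" and ne: "\<And>n. C n \<noteq> {}"
  shows "(\<Inter>n. C n) \<noteq> {}"
proof -
  define d where "d n = infdist 0 (C n)" for n
  define e where "e n = 1 / real (Suc n)" for n
  have "\<exists>u\<in>C n. norm u < d n + e n" for n
    using infdist_approached[OF ne[of n], of "e n" 0] by (simp add: d_def e_def)
  then obtain u where uC: "\<And>n. u n \<in> C n" and u_near: "\<And>n. norm (u n) < d n + e n"
    by metis
  have d_le: "d n \<le> norm v" if "v \<in> C n" for n v
    using infdist_le[OF that, of 0] by (simp add: d_def)
  have d_nonneg: "0 \<le> d n" for n by (simp add: d_def infdist_nonneg)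
  have d_mono: "incseq d"
    unfolding incseq_def d_def
    using dec ne by (auto intro!: infdist_mono simp: decseq_def)
  obtain R where R: "\<And>v. v \<in> C 0 \<Longrightarrow> norm v \<le> R"
    using bdd by (auto simp: bounded_iff)
  have "d n \<le> R" for n
    using d_le[OF uC[of n]] R[of "u n"] uC[of n] decseqD[OF dec, of 0 n] by force
  then obtain L where L: "d \<longlonglongrightarrow> L" and dL: "\<And>n. d n \<le> L"
    using incseq_convergent[OF d_mono] by metis
  have gap: "(dist (u m) (u n))\<^sup>2 \<le> 4 * (L + e N)\<^sup>2 - 4 * (d N)\<^sup>2" if "N \<le> n" "N \<le> m" for N m n
  proof -
    have near: "(norm (u k))\<^sup>2 \<le> (L + e N)\<^sup>2" if "N \<le> k" for k
    proof (rule power_mono)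
      have "e k \<le> e N" using that by (simp add: e_def field_simps)
      then show "norm (u k) \<le> L + e N" using u_near[of k] dL[of k] by linarith
    qed simp
    have "u n \<in> C N" "u m \<in> C N"
      using uC decseqD[OF dec] that by blast+
    then have "(1/2) *\<^sub>R u m + (1/2) *\<^sub>R u n \<in> C N"
      by (intro convexD[OF conv]) auto
    then have "d N \<le> norm ((1/2) *\<^sub>R u m + (1/2) *\<^sub>R u n)" by (rule d_le)
    then have "(d N)\<^sup>2 \<le> (norm ((1/2) *\<^sub>R u m + (1/2) *\<^sub>R u n))\<^sup>2"
      by (intro power_mono d_nonneg)
    also have "\<dots> = ((norm (u m))\<^sup>2 + (norm (u n))\<^sup>2) / 2 - (dist (u m) (u n))\<^sup>2 / 4"
      unfolding dist_norm power2_norm_eq_inner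
      by (simp add: inner_simps inner_commute field_simps)
    finally have "(dist (u m) (u n))\<^sup>2 \<le> 2 * (norm (u m))\<^sup>2 + 2 * (norm (u n))\<^sup>2 - 4 * (d N)\<^sup>2"
      by (simp add: field_simps)
    then show ?thesis
      using mult_left_mono[OF near[OF that(1)], of 2] mult_left_mono[OF near[OF that(2)], of 2] by simp
  qed
  have "e \<longlonglongrightarrow> 0"
    using LIMSEQ_inverse_real_of_nat unfolding e_def by (simp add: inverse_eq_divide)
  then have gap0: "(\<lambda>N. 4 * (L + e N)\<^sup>2 - 4 * (d N)\<^sup>2) \<longlonglongrightarrow> 4 * (L + 0)\<^sup>2 - 4 * L\<^sup>2"
    by (intro tendsto_intros L)
  have "Cauchy u"
  proof (rule metric_CauchyI)
    fix r :: real assume r: "0 < r"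
    have "\<forall>\<^sub>F N in sequentially. 4 * (L + e N)\<^sup>2 - 4 * (d N)\<^sup>2 < r\<^sup>2"
      using order_tendstoD(2)[OF gap0, of "r\<^sup>2"] r by simp
    then obtain N where N: "4 * (L + e N)\<^sup>2 - 4 * (d N)\<^sup>2 < r\<^sup>2"
      by (auto simp: eventually_sequentially)
    have "dist (u m) (u n) < r" if "N \<le> m" "N \<le> n" for m n
      using gap[OF that(2) that(1)] N r
      by (intro power2_less_imp_less[of _ r]) linarith+
    then show "\<exists>M. \<forall>m\<ge>M. \<forall>n\<ge>M. dist (u m) (u n) < r" by blast
  qed
  then obtain v where v: "u \<longlonglongrightarrow> v"
    using Cauchy_convergent_iff convergent_def by metis
  have "v \<in> C n" for n
  proof (rule Lim_in_closed_set[OF cl _ _ v])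
    show "\<forall>\<^sub>F k in sequentially. u k \<in> C n"
      using eventually_ge_at_top[of n] by eventually_elim (use uC decseqD[OF dec] in blast)
  qed simp
  then show ?thesis by blast
qed

text \<open>The points of \<open>C\<close> that come within \<open>1 / (n + 1)\<close> of the distance from \<open>p\<close> form a
  decreasing sequence of bounded closed convex sets; a common point is a nearest point, and the
  obtuse angle criterion is known for any nearest point.\<close>

lemma obtuse_angle_projection:
  fixes C :: "'a::{real_inner, complete_space} set"
  assumes "closed C" "convex C" "C \<noteq> {}"
  obtains q where "q \<in> C" "\<And>c. c \<in> C \<Longrightarrow> (p - q) \<bullet> (c - q) \<le> 0"
proof -
  define D where "D n = C \<inter> cball p (infdist p C + 1 / real (Suc n))" for n
  have "(\<Inter>n. D n) \<noteq> {}"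
  proof (rule nested_closed_convex_sets_meet)
    show "decseq D"
    proof (rule decseq_SucI)
      fix n
      have "1 / real (Suc (Suc n)) \<le> 1 / real (Suc n)" by (simp add: field_simps)
      then show "D (Suc n) \<subseteq> D n" unfolding D_def by (intro Int_mono subset_cball) auto
    qed
    show "bounded (D 0)" by (simp add: D_def bounded_Int)
    show "D n \<noteq> {}" for n
    proof -
      obtain c where "c \<in> C" "dist p c < infdist p C + 1 / real (Suc n)"
        using infdist_approached[OF assms(3), of "1 / real (Suc n)" p] by auto
      then show ?thesis by (auto simp: D_def intro!: exI[of _ c])
    qed
  qed (use assms in \<open>auto simp: D_def intro: convex_Int\<close>)
  then obtain q where q: "\<And>n. q \<in> D n" by blast
  have "dist p q \<le> infdist p C"
  proof (rule LIMSEQ_le_const)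
    show "(\<lambda>n. infdist p C + 1 / real (Suc n)) \<longlonglongrightarrow> infdist p C"
      using tendsto_add[OF tendsto_const LIMSEQ_inverse_real_of_nat, of "infdist p C"]
      by (simp add: inverse_eq_divide)
  qed (use q in \<open>auto simp: D_def\<close>)
  then have q_min: "dist p q \<le> dist p c" if "c \<in> C" for c
    using infdist_le[OF that, of p] by linarith
  have "q \<in> C" using q by (auto simp: D_def)
  moreover have "(p - q) \<bullet> (c - q) \<le> 0" if "c \<in> C" for c
    using any_closest_point_dot[OF assms(2,1) \<open>q \<in> C\<close> that, of p] q_min by blast
  ultimately show thesis by (rule that)
qed

text \<open>Lowering the point \<open>(x, f x)\<close> by \<open>\<epsilon>\<close> puts it at positive distance from the epigraph. Its
  projection onto the epigraph gives a hyperplane that is not vertical, and the slope of that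
  hyperplane is the required vector.\<close>

lemma approximate_subgradient_exists:
  fixes f :: "'a::{real_inner, complete_space} \<Rightarrow> real"
  assumes cont: "continuous_on UNIV f" and conv: "convex_on UNIV f" and eps: "0 < \<epsilon>"
  shows "\<exists>u. \<forall>y. f y \<ge> f x + (y - x) \<bullet> u - \<epsilon>"
proof -
  define E where "E = {w. f (fst w) \<le> snd w}"
  have "closed E"
    unfolding E_def
    by (intro closed_Collect_le continuous_intros continuous_on_compose2[OF cont]) auto
  moreover have "convex E"
  proof -
    have "E = epigraph UNIV f" by (auto simp: E_def epigraph_def)
    then show ?thesis using conv by (simp add: convex_epigraph)
  qed
  moreover have graph: "(y, f y) \<in> E" for y by (simp add: E_def)
  ultimately obtain w where w: "w \<in> E"
    and obtuse: "\<And>c. c \<in> E \<Longrightarrow> ((x, f x - \<epsilon>) - w) \<bullet> (c - w) \<le> 0"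
    using obtuse_angle_projection[of E "(x, f x - \<epsilon>)"] by blast
  obtain p s where ps: "w = (p, s)" by fastforce
  define v \<tau> where "v = x - p" and "\<tau> = s - (f x - \<epsilon>)"
  \<comment> \<open>\<open>(v, - \<tau>)\<close> is the normal of the separating hyperplane; its slope is \<open>v / \<tau>\<close>.\<close>
  have sep: "v \<bullet> (y - p) \<le> \<tau> * (t - s)" if "f y \<le> t" for y t
    using obtuse[of "(y, t)"] that unfolding ps v_def \<tau>_def E_def
    by (simp add: inner_prod_def algebra_simps)
  \<comment> \<open>Testing the separation at \<open>(x, f x)\<close> forces \<open>\<tau> > 0\<close>, so the hyperplane is not vertical.\<close>
  have at_x: "v \<bullet> v \<le> \<tau> * (\<epsilon> - \<tau>)"
    using sep[of x "f x"] by (simp add: v_def \<tau>_def algebra_simps)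
  then have "0 \<le> \<tau> * (\<epsilon> - \<tau>)" using inner_ge_zero[of v] by linarith
  then have "0 \<le> \<tau>" using eps by (auto simp: zero_le_mult_iff)
  moreover have "\<tau> \<noteq> 0"
  proof
    assume "\<tau> = 0"
    moreover from this have "v = 0" using at_x inner_ge_zero[of v] by simp
    ultimately have "w = (x, f x - \<epsilon>)" by (simp add: ps v_def \<tau>_def)
    then show False using w eps by (simp add: E_def)
  qed
  ultimately have pos: "0 < \<tau>" by simp
  have "f x + (y - x) \<bullet> ((1 / \<tau>) *\<^sub>R v) - \<epsilon> \<le> f y" for y
  proof -
    have "(y - x) \<bullet> v = v \<bullet> (y - p) - v \<bullet> v"
      by (simp add: v_def inner_simps inner_commute)
    also have "\<dots> \<le> \<tau> * (f y - s)" using sep[of y "f y"] inner_ge_zero[of v] by linarith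
    also have "\<dots> \<le> \<tau> * (f y - (f x - \<epsilon>))"
      using pos by (simp add: \<tau>_def)
    finally show ?thesis using pos by (simp add: field_simps)
  qed
  then show ?thesis by blast
qed

text \<open>The \<open>\<epsilon>\<close>-subdifferentials shrink to the subdifferential as \<open>\<epsilon>\<close> decreases to \<open>0\<close>. They are
  closed and convex, and continuity of \<open>f\<close> at \<open>x\<close> bounds the one for \<open>\<epsilon> = 1\<close>, so they have a
  common point.\<close>

lemma subdifferential_nonempty:
  fixes f :: "'a::{real_inner, complete_space} \<Rightarrow> real"
  assumes cont: "continuous_on UNIV f" and conv: "convex_on UNIV f"
  shows "subdifferential f x \<noteq> {}"
proof -
  define C where "C n = {u. \<forall>y. f x + (y - x) \<bullet> u - 1 / real (Suc n) \<le> f y}" for n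
  have "(\<Inter>n. C n) \<noteq> {}"
  proof (rule nested_closed_convex_sets_meet)
    show "decseq C"
    proof (rule decseq_SucI)
      fix n
      have "1 / real (Suc (Suc n)) \<le> 1 / real (Suc n)" by (simp add: field_simps)
      moreover have "f x + (y - x) \<bullet> u - 1 / real (Suc (Suc n)) \<le> f y"
        if "u \<in> C (Suc n)" for u y
        using that unfolding C_def by blast
      ultimately have "f x + (y - x) \<bullet> u - 1 / real (Suc n) \<le> f y"
        if "u \<in> C (Suc n)" for u y
        using that by (meson diff_left_mono order_trans)
      then show "C (Suc n) \<subseteq> C n" unfolding C_def by blast
    qed
    show "closed (C n)" for n
      unfolding C_def by (intro closed_Collect_all closed_Collect_le continuous_intros)
    show "convex (C n)" for n
    proof -
      have "C n = (\<Inter>y. {u. (y - x) \<bullet> u \<le> f y - f x + 1 / real (Suc n)})"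
        by (auto simp: C_def algebra_simps)
      then show ?thesis by (simp add: convex_INT convex_halfspace_le)
    qed
    show "C n \<noteq> {}" for n
      using approximate_subgradient_exists[OF cont conv, of "1 / real (Suc n)" x]
      by (auto simp: C_def)
    show "bounded (C 0)"
    proof -
      have "isCont f x" using cont by (simp add: continuous_on_eq_continuous_at)
      then obtain \<delta> where \<delta>: "0 < \<delta>" "\<And>y. dist y x < \<delta> \<Longrightarrow> dist (f y) (f x) < 1"
        by (auto simp: continuous_at_eps_delta) (meson zero_less_one)
      have "norm u \<le> 4 / \<delta>" if u: "u \<in> C 0" for u
      proof (cases "u = 0")
        case False
        \<comment> \<open>Moving in the direction of \<open>u\<close>, \<open>f\<close> rises at the rate \<open>norm u\<close>, but it rises by less
          than \<open>1\<close> within distance \<open>\<delta>\<close>.\<close>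
        define y where "y = x + (\<delta> / 2) *\<^sub>R ((1 / norm u) *\<^sub>R u)"
        have "dist y x < \<delta>" using \<delta>(1) False by (simp add: y_def dist_norm)
        then have "f y < f x + 1" using \<delta>(2)[of y] by (simp add: dist_real_def)
        moreover have "f x + (y - x) \<bullet> u - 1 \<le> f y" using u by (simp add: C_def)
        moreover have "(y - x) \<bullet> u = \<delta> / 2 * norm u"
          using False by (simp add: y_def power2_norm_eq_inner[symmetric] power2_eq_square)
        ultimately show ?thesis using \<delta>(1) by (simp add: field_simps)
      qed (use \<delta>(1) in simp)
      then show ?thesis by (auto simp: bounded_iff)
    qed
  qed
  then obtain u where u: "\<And>n. u \<in> C n" by blast
  have "f x + (y - x) \<bullet> u \<le> f y" for y
  proof (rule LIMSEQ_le_const2)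
    show "(\<lambda>n. f x + (y - x) \<bullet> u - 1 / real (Suc n)) \<longlonglongrightarrow> f x + (y - x) \<bullet> u"
      using tendsto_diff[OF tendsto_const LIMSEQ_inverse_real_of_nat, of "f x + (y - x) \<bullet> u"]
      by (simp add: inverse_eq_divide)
  qed (use u in \<open>auto simp: C_def\<close>)
  then show ?thesis by (auto simp: subdifferential_def)
qed

section \<open>One step of the method\<close>

text \<open>The identity for the norm of a convex combination gains \<open>a (1 - a)\<close> times the squared residual
  \<open>norm (x - Q x)\<close>, and quasi-firm nonexpansiveness gains another \<open>1 - a\<close>, which makes \<open>1 - a\<^sup>2\<close>
  in total.\<close>

lemma averaged_map_subgradient_step:
  fixes Q :: "'a::real_inner \<Rightarrow> 'a"
  assumes qfne: "quasi_firmly_nonexpansive Q" and y: "y \<in> Fix Q" and a: "0 < a" "a < 1"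
  shows "(norm (averaged_map a Q x - l *\<^sub>R g - y))\<^sup>2
    \<le> (norm (x - y))\<^sup>2 - (1 - a\<^sup>2) * (norm (x - Q x))\<^sup>2
        + 2 * l * ((y - averaged_map a Q x) \<bullet> g) + l\<^sup>2 * (norm g)\<^sup>2"
proof -
  define w where "w = averaged_map a Q x"
  have eq: "w - y = a *\<^sub>R (x - y) + (1 - a) *\<^sub>R (Q x - y)"
    by (simp add: w_def averaged_map_def algebra_simps)
  have "(norm (w - y))\<^sup>2
      = a * (norm (x - y))\<^sup>2 + (1 - a) * (norm (Q x - y))\<^sup>2 - a * (1 - a) * (norm ((x - y) - (Q x - y)))\<^sup>2"
    unfolding eq power2_norm_eq_inner by (simp add: inner_simps inner_commute algebra_simps power2_eq_square)
  also have "(x - y) - (Q x - y) = x - Q x" by simp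
  also have "(1 - a) * (norm (Q x - y))\<^sup>2 \<le> (1 - a) * ((norm (x - y))\<^sup>2 - (norm (x - Q x))\<^sup>2)"
    using qfne y a unfolding quasi_firmly_nonexpansive_def
    by (intro mult_left_mono) (auto simp: algebra_simps)
  finally have avg: "(norm (w - y))\<^sup>2 \<le> (norm (x - y))\<^sup>2 - (1 - a\<^sup>2) * (norm (x - Q x))\<^sup>2"
    by (simp add: algebra_simps power2_eq_square)
  have "(norm (w - l *\<^sub>R g - y))\<^sup>2
      = (norm (w - y))\<^sup>2 + 2 * l * ((y - w) \<bullet> g) + l\<^sup>2 * (norm g)\<^sup>2"
    unfolding power2_norm_eq_inner by (simp add: inner_simps inner_commute algebra_simps power2_eq_square)
  then show ?thesis using avg by (simp add: w_def)
qed

lemma norm_diff_averaged_map: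
  assumes "a < 1"
  shows "norm (x - averaged_map a Q x) = (1 - a) * norm (x - Q x)"
proof -
  have "x - averaged_map a Q x = (1 - a) *\<^sub>R (x - Q x)"
    by (simp add: averaged_map_def algebra_simps)
  then show ?thesis using assms by simp
qed

lemma norm_mean_diff_square_le:
  fixes v :: "nat \<Rightarrow> 'a::real_inner"
  assumes "1 \<le> I"
  shows "(norm ((1 / real I) *\<^sub>R (\<Sum>i\<in>{1..I}. v i) - y))\<^sup>2
    \<le> (1 / real I) * (\<Sum>i\<in>{1..I}. (norm (v i - y))\<^sup>2)"
proof -
  have "(1 / real I) *\<^sub>R (\<Sum>i\<in>{1..I}. v i) - y = (1 / real I) *\<^sub>R (\<Sum>i\<in>{1..I}. v i - y)"
    using assms by (simp add: sum_subtractf scaleR_right_diff_distrib flip: scaleR_scaleR)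
      (simp add: sum_constant_scaleR)
  then have "(norm ((1 / real I) *\<^sub>R (\<Sum>i\<in>{1..I}. v i) - y))\<^sup>2
      = (1 / real I)\<^sup>2 * (norm (\<Sum>i\<in>{1..I}. v i - y))\<^sup>2"
    by (simp add: power_mult_distrib power_divide)
  also have "(norm (\<Sum>i\<in>{1..I}. v i - y))\<^sup>2 \<le> (\<Sum>i\<in>{1..I}. norm (v i - y))\<^sup>2"
    by (intro power_mono norm_sum) simp
  also have "\<dots> \<le> (\<Sum>i\<in>{1..I}. (norm (v i - y))\<^sup>2) * real I"
    using sum_squared_le_sum_of_squares[of "\<lambda>i. norm (v i - y)" "{1..I}"] by simp
  also have "(1 / real I)\<^sup>2 * \<dots> = (1 / real I) * (\<Sum>i\<in>{1..I}. (norm (v i - y))\<^sup>2)"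
    using assms by (simp add: power2_eq_square)
  finally show ?thesis by (simp add: mult_left_mono)
qed

text \<open>The constant \<open>M_lam\<close> of the theorem pairs \<open>g\<close> with \<open>y - x\<close>, not with
  \<open>y - averaged_map a Q x\<close>.
  Exchanging the two by Young's inequality costs \<open>(1 - a)\<^sup>2\<close> of the \<open>1 - a\<^sup>2\<close> gained on the squared
  residual, which leaves \<open>2 a (1 - a)\<close>, and one more term \<open>l\<^sup>2 * (norm g)\<^sup>2\<close>.\<close>

lemma fixed_point_residual_step:
  fixes Q :: "'a::real_inner \<Rightarrow> 'a"
  assumes qfne: "quasi_firmly_nonexpansive Q" and y: "y \<in> Fix Q" and a: "0 < a" "a < 1"
  shows "(norm (averaged_map a Q x - l *\<^sub>R g - y))\<^sup>2
    \<le> (norm (x - y))\<^sup>2 - 2 * (a * (1 - a) * (norm (x - Q x))\<^sup>2)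
        + 2 * l * ((y - x) \<bullet> g) + 2 * l\<^sup>2 * (norm g)\<^sup>2"
proof -
  define w where "w = averaged_map a Q x"
  have "0 \<le> (norm ((x - w) - l *\<^sub>R g))\<^sup>2" by simp
  also have "\<dots> = (norm (x - w))\<^sup>2 - 2 * l * ((x - w) \<bullet> g) + l\<^sup>2 * (norm g)\<^sup>2"
    unfolding power2_norm_eq_inner by (simp add: inner_simps inner_commute algebra_simps power2_eq_square)
  also have "(norm (x - w))\<^sup>2 = (1 - a)\<^sup>2 * (norm (x - Q x))\<^sup>2"
    using a by (simp add: w_def norm_diff_averaged_map power_mult_distrib)
  finally have "2 * l * ((x - w) \<bullet> g) \<le> (1 - a)\<^sup>2 * (norm (x - Q x))\<^sup>2 + l\<^sup>2 * (norm g)\<^sup>2"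
    by simp
  moreover have "2 * l * ((y - w) \<bullet> g) = 2 * l * ((y - x) \<bullet> g) + 2 * l * ((x - w) \<bullet> g)"
    by (simp add: inner_simps algebra_simps)
  moreover have "(1 - a\<^sup>2) * (norm (x - Q x))\<^sup>2 - (1 - a)\<^sup>2 * (norm (x - Q x))\<^sup>2
      = 2 * (a * (1 - a) * (norm (x - Q x))\<^sup>2)"
    by algebra
  ultimately show ?thesis
    using averaged_map_subgradient_step[OF assms, of x l g] unfolding w_def by linarith
qed

text \<open>Two subgradients are used: \<open>g\<close>, at the averaged point, compares \<open>f\<close> there with \<open>f y\<close>, and \<open>u\<close>,
  at \<open>x\<close>, bounds the loss of passing from the averaged point back to \<open>x\<close>.\<close>

lemma objective_step:
  fixes Q :: "'a::real_inner \<Rightarrow> 'a"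
  assumes qfne: "quasi_firmly_nonexpansive Q" and y: "y \<in> Fix Q" and a: "0 < a" "a < 1"
    and l: "0 \<le> l" and g: "g \<in> subdifferential f (averaged_map a Q x)"
    and u: "u \<in> subdifferential f x" and uM: "norm u \<le> M"
  shows "(norm (averaged_map a Q x - l *\<^sub>R g - y))\<^sup>2
    \<le> (norm (x - y))\<^sup>2 + 2 * l * (f y - f x + M * ((1 - a) * norm (x - Q x)))
        + l\<^sup>2 * (norm g)\<^sup>2"
proof -
  define w where "w = averaged_map a Q x"
  have "f x + (w - x) \<bullet> u \<le> f w" using u by (simp add: subdifferential_def)
  moreover have "- ((w - x) \<bullet> u) \<le> M * ((1 - a) * norm (x - Q x))"
  proof -
    have "- ((w - x) \<bullet> u) = (x - w) \<bullet> u" by (simp add: inner_simps)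
    also have "\<dots> \<le> norm (x - w) * norm u" by (rule norm_cauchy_schwarz)
    also have "\<dots> \<le> norm (x - w) * M" using uM by (intro mult_left_mono) auto
    finally show ?thesis using a by (simp add: w_def norm_diff_averaged_map mult.commute)
  qed
  moreover have "f w + (y - w) \<bullet> g \<le> f y" using g by (simp add: subdifferential_def w_def)
  ultimately have "(y - w) \<bullet> g \<le> f y - f x + M * ((1 - a) * norm (x - Q x))" by linarith
  then have "2 * l * ((y - w) \<bullet> g) \<le> 2 * l * (f y - f x + M * ((1 - a) * norm (x - Q x)))"
    using l by (intro mult_left_mono) auto
  moreover have "0 \<le> (1 - a\<^sup>2) * (norm (x - Q x))\<^sup>2"
    using a by (intro mult_nonneg_nonneg) (auto simp: power_le_one)
  ultimately show ?thesis
    using averaged_map_subgradient_step[OF qfne y a, of x l g] unfolding w_def by linarith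
qed

text \<open>The inequality between arithmetic and geometric means, \<open>2 T s \<le> T\<^sup>2 + s\<^sup>2\<close>, for the
  displacement \<open>s = (1 - a) * r\<close> and for the value \<open>T\<close> that \<open>s\<close> takes when the weighted squared
  residual \<open>a * (1 - a) * r\<^sup>2\<close> equals \<open>S\<close>. It turns a quantity linear in the residual into one
  that a decrease of order \<open>r\<^sup>2\<close> can absorb.\<close>

lemma displacement_le_weighted_residual:
  assumes a: "0 < a" "a < 1" and S: "0 < S"
  shows "(1 - a) * r \<le> sqrt ((1 - a) * S / a) * (1 + a * (1 - a) * r\<^sup>2 / S) / 2"
proof -
  define T where "T = sqrt ((1 - a) * S / a)"
  have T: "0 < T" and T2: "T\<^sup>2 = (1 - a) * S / a" using a S by (simp_all add: T_def)
  have "T * (T * (1 + a * (1 - a) * r\<^sup>2 / S)) = T\<^sup>2 * (1 + a * (1 - a) * r\<^sup>2 / S)"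
    by (simp add: power2_eq_square)
  also have "\<dots> = T\<^sup>2 + ((1 - a) * r)\<^sup>2"
    unfolding T2 using a S by (simp add: field_simps power2_eq_square)
  finally have "T * (2 * ((1 - a) * r)) \<le> T * (T * (1 + a * (1 - a) * r\<^sup>2 / S))"
    using sum_squares_bound[of T "(1 - a) * r"] by (simp add: algebra_simps)
  then have "2 * ((1 - a) * r) \<le> T * (1 + a * (1 - a) * r\<^sup>2 / S)"
    using T by (simp only: mult_le_cancel_left_pos)
  then show ?thesis by (simp add: T_def)
qed

section \<open>Asymptotic bounds\<close>

text \<open>If \<open>h\<close> eventually stayed above some \<open>b > c\<close>, each later step would lower \<open>V\<close> by at least
  \<open>k * (b - c)\<close>, and \<open>V\<close> would become negative.\<close>

lemma liminf_le_of_bounded_increase: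
  fixes V h :: "nat \<Rightarrow> real"
  assumes nonneg: "\<And>n. 0 \<le> V n"
    and step: "\<And>n. V (Suc n) \<le> V n + k * (c - h n)" and k: "0 < k"
  shows "liminf (\<lambda>n. ereal (h n)) \<le> ereal c"
proof (rule ccontr)
  assume "\<not> ?thesis"
  then have "ereal c < liminf (\<lambda>n. ereal (h n))" by simp
  then obtain b where b: "ereal c < ereal b" "ereal b < liminf (\<lambda>n. ereal (h n))"
    using ereal_dense2 by blast
  from less_LiminfD[OF b(2)] obtain N where N: "\<And>n. N \<le> n \<Longrightarrow> b < h n"
    by (auto simp: eventually_sequentially)
  have decay: "V (N + j) \<le> V N - real j * (k * (b - c))" for j
  proof (induction j)
    case (Suc j)
    have "k * (c - h (N + j)) \<le> k * (c - b)"
      using N[of "N + j"] k by (intro mult_left_mono) auto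
    then show ?case using Suc step[of "N + j"] by (simp add: algebra_simps)
  qed simp
  have "0 < k * (b - c)" using b(1) k by simp
  then obtain j where "V N < real j * (k * (b - c))" using reals_Archimedean3 by blast
  then show False using decay[of j] nonneg[of "N + j"] by linarith
qed

theorem theorem3p1:
  fixes I :: nat
    and f :: "nat \<Rightarrow> 'a::{real_inner, complete_space} \<Rightarrow> real"
    and Q :: "nat \<Rightarrow> 'a \<Rightarrow> 'a"
    and \<alpha> :: "nat \<Rightarrow> real"
    and lam :: real
    and x :: "nat \<Rightarrow> 'a"
    and g :: "nat \<Rightarrow> nat \<Rightarrow> 'a"
    and B1 B2 :: "nat \<Rightarrow> real"
    and M1 M2 :: real
    and M_lam :: ereal
    and z :: 'a
  assumes "1 \<le> I"
    and "\<And>i. i \<in> {1..I} \<Longrightarrow> 0 < \<alpha> i \<and> \<alpha> i < 1"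
    and "\<And>i. i \<in> {1..I} \<Longrightarrow> quasi_firmly_nonexpansive (Q i)"
    and "\<And>i. i \<in> {1..I} \<Longrightarrow> continuous_on UNIV (f i)"
    and "\<And>i. i \<in> {1..I} \<Longrightarrow> convex_on UNIV (f i)"
    and "solution_set I f Q \<noteq> {}"
    and "0 < lam"
    and "parallel_subgradient_method I f Q \<alpha> (\<lambda>n. lam) x g"
    and "\<And>i. i \<in> {1..I} \<Longrightarrow>
           Sup {ereal (norm u) | u n. u \<in> subdifferential (f i) (averaged_map (\<alpha> i) (Q i) (x n))}
             \<le> ereal (B1 i)"
    and "\<And>i. i \<in> {1..I} \<Longrightarrow>
           Sup {ereal (norm u) | u n. u \<in> subdifferential (f i) (x n)} \<le> ereal (B2 i)"
    and "M1 = (MAX i\<in>{1..I}. (B1 i)\<^sup>2)"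
    and "M2 = (MAX i\<in>{1..I}. B2 i)"
    and "z \<in> constraint_set I Q"
    and "M_lam = (SUP n. ereal (M1 * lam + 1 / real I * \<bar>\<Sum>i\<in>{1..I}. (z - x n) \<bullet> g i n\<bar>))"
  shows "(\<forall>i\<in>{1..I}.
           liminf (\<lambda>n. ereal ((norm (x n - Q i (x n)))\<^sup>2))
             \<le> (if M_lam = \<infinity> then \<infinity>
                else ereal (real I * real_of_ereal M_lam * lam / (\<alpha> i * (1 - \<alpha> i))))) \<and>
         liminf (\<lambda>n. ereal (total_objective I f (x n)))
           \<le> (if M_lam = \<infinity> then \<infinity>
              else optimal_value I f Q
                + ereal (real I * M1 * lam
                    + (sqrt M1 + M2) *
                      (\<Sum>i\<in>{1..I}.
                         sqrt ((1 - \<alpha> i) * real I * real_of_ereal M_lam * lam / \<alpha> i))))"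
proof (cases "M_lam = \<infinity>")
  case True
  then show ?thesis by simp
next
  case False
  define w where "w i n = averaged_map (\<alpha> i) (Q i) (x n)" for i n
  define r where "r i n = norm (x n - Q i (x n))" for i n
  define D where "D n = (\<Sum>i\<in>{1..I}. \<alpha> i * (1 - \<alpha> i) * (r i n)\<^sup>2)" for n
  define L where "L = real_of_ereal M_lam"
  have I: "0 < real I" using assms(1) by simp
  note a = assms(2) and qfne = assms(3) and M1 = assms(11) and M2 = assms(12)

  have sub: "g i n \<in> subdifferential (f i) (w i n)" if "i \<in> {1..I}" for i n
    using assms(8) that by (simp add: parallel_subgradient_method_def w_def)
  have x_Suc: "x (Suc n) = (1 / real I) *\<^sub>R (\<Sum>i\<in>{1..I}. w i n - lam *\<^sub>R g i n)" for n
    using assms(8) by (simp add: parallel_subgradient_method_def w_def)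
  have g_le: "(norm (g i n))\<^sup>2 \<le> M1" if i: "i \<in> {1..I}" for i n
  proof -
    have "ereal (norm (g i n)) \<le> ereal (B1 i)"
      using sub[OF i, of n] by (intro order_trans[OF Sup_upper assms(9)[OF i]]) (auto simp: w_def)
    then have "(norm (g i n))\<^sup>2 \<le> (B1 i)\<^sup>2" by (intro power_mono) auto
    also have "\<dots> \<le> M1" unfolding M1 using i by (intro Max_ge) auto
    finally show ?thesis .
  qed
  have sub_le: "norm u \<le> M2" if i: "i \<in> {1..I}" and u: "u \<in> subdifferential (f i) (x n)" for i n u
  proof -
    have "ereal (norm u) \<le> ereal (B2 i)"
      using u by (intro order_trans[OF Sup_upper assms(10)[OF i]]) auto
    also have "B2 i \<le> M2" unfolding M2 using i by (intro Max_ge) auto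
    finally show ?thesis by simp
  qed
  have sub_ne: "\<exists>u. u \<in> subdifferential (f i) (x n)" if "i \<in> {1..I}" for i n
    using subdifferential_nonempty[OF assms(4,5)[OF that], of "x n"] by blast
  have M1_nonneg: "0 \<le> M1" using g_le[of 1 0] assms(1) by (force intro: order_trans[OF zero_le_power2])
  have M2_nonneg: "0 \<le> M2"
    using sub_ne[of 1 0] sub_le[of 1 _ 0] assms(1) by (force intro: order_trans[OF norm_ge_zero])
  have in_Fix: "y \<in> Fix (Q i)" if "y \<in> constraint_set I Q" "i \<in> {1..I}" for y i
    using that by (auto simp: constraint_set_def)

  have L_ge: "M1 * lam + 1 / real I * \<bar>\<Sum>i\<in>{1..I}. (z - x n) \<bullet> g i n\<bar> \<le> L" for n
  proof -
    have "ereal (M1 * lam + 1 / real I * \<bar>\<Sum>i\<in>{1..I}. (z - x n) \<bullet> g i n\<bar>) \<le> M_lam"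
      unfolding assms(14) by (rule SUP_upper) simp
    then show ?thesis using False by (cases M_lam) (auto simp: L_def)
  qed
  have M1_le_L: "M1 * lam \<le> L"
    using L_ge[of 0] I by (smt (verit) abs_ge_zero divide_nonneg_pos mult_nonneg_nonneg)
  have L_nonneg: "0 \<le> L" using M1_le_L M1_nonneg assms(7) by (meson mult_nonneg_nonneg order_trans less_imp_le)

  \<comment> \<open>The weighted residuals \<open>D n\<close> may exceed \<open>I * L * lam\<close> only at the expense of the distance
    to \<open>z\<close>.\<close>
  have residual_decrease:
    "(norm (x (Suc n) - z))\<^sup>2 \<le> (norm (x n - z))\<^sup>2 + 2 / real I * (real I * L * lam - D n)" for n
  proof -
    have "(norm (x (Suc n) - z))\<^sup>2
        \<le> (1 / real I) * (\<Sum>i\<in>{1..I}. (norm (w i n - lam *\<^sub>R g i n - z))\<^sup>2)"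
      unfolding x_Suc by (rule norm_mean_diff_square_le[OF assms(1)])
    also have "\<dots> \<le> (1 / real I) * (\<Sum>i\<in>{1..I}. (norm (x n - z))\<^sup>2
        - 2 * (\<alpha> i * (1 - \<alpha> i) * (r i n)\<^sup>2) + 2 * lam * ((z - x n) \<bullet> g i n) + 2 * lam\<^sup>2 * M1)"
    proof (intro mult_left_mono sum_mono)
      fix i assume i: "i \<in> {1..I}"
      have "2 * lam\<^sup>2 * (norm (g i n))\<^sup>2 \<le> 2 * lam\<^sup>2 * M1"
        using g_le[OF i] by (intro mult_left_mono) auto
      then show "(norm (w i n - lam *\<^sub>R g i n - z))\<^sup>2 \<le> (norm (x n - z))\<^sup>2
        - 2 * (\<alpha> i * (1 - \<alpha> i) * (r i n)\<^sup>2) + 2 * lam * ((z - x n) \<bullet> g i n) + 2 * lam\<^sup>2 * M1"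
        using fixed_point_residual_step[OF qfne[OF i] in_Fix[OF assms(13) i], of "\<alpha> i" "x n" lam "g i n"]
          a[OF i] unfolding w_def r_def by linarith
    qed simp
    also have "\<dots> = (norm (x n - z))\<^sup>2 - 2 / real I * D n
        + 2 * lam * (M1 * lam + 1 / real I * (\<Sum>i\<in>{1..I}. (z - x n) \<bullet> g i n))"
    proof -
      have split: "(\<Sum>i\<in>{1..I}. (norm (x n - z))\<^sup>2
          - 2 * (\<alpha> i * (1 - \<alpha> i) * (r i n)\<^sup>2) + 2 * lam * ((z - x n) \<bullet> g i n) + 2 * lam\<^sup>2 * M1)
        = real I * (norm (x n - z))\<^sup>2 - 2 * D n
          + 2 * lam * (\<Sum>i\<in>{1..I}. (z - x n) \<bullet> g i n) + real I * (2 * lam\<^sup>2 * M1)"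
        unfolding D_def by (simp add: sum.distrib sum_subtractf flip: sum_distrib_left)
      show ?thesis unfolding split using I by (simp add: field_simps power2_eq_square)
    qed
    also have "\<dots> \<le> (norm (x n - z))\<^sup>2 - 2 / real I * D n + 2 * lam * L"
    proof -
      have "1 / real I * (\<Sum>i\<in>{1..I}. (z - x n) \<bullet> g i n)
          \<le> 1 / real I * \<bar>\<Sum>i\<in>{1..I}. (z - x n) \<bullet> g i n\<bar>"
        using I by (intro mult_left_mono) auto
      then have "M1 * lam + 1 / real I * (\<Sum>i\<in>{1..I}. (z - x n) \<bullet> g i n) \<le> L"
        using L_ge[of n] by linarith
      then show ?thesis using assms(7) by simp
    qed
    finally show ?thesis using I by (simp add: field_simps)
  qed

  \<comment> \<open>The objective may exceed its value at a feasible \<open>y\<close>, up to an error linear in the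
    residuals, only at the expense of the distance to \<open>y\<close>.\<close>
  have objective_decrease:
    "(norm (x (Suc n) - y))\<^sup>2 \<le> (norm (x n - y))\<^sup>2
       + 2 * lam / real I * (total_objective I f y + real I * M1 * lam / 2
           + M2 * (\<Sum>i\<in>{1..I}. (1 - \<alpha> i) * r i n) - total_objective I f (x n))"
    if y: "y \<in> constraint_set I Q" for y n
  proof -
    have "(norm (x (Suc n) - y))\<^sup>2
        \<le> (1 / real I) * (\<Sum>i\<in>{1..I}. (norm (w i n - lam *\<^sub>R g i n - y))\<^sup>2)"
      unfolding x_Suc by (rule norm_mean_diff_square_le[OF assms(1)])
    also have "\<dots> \<le> (1 / real I) * (\<Sum>i\<in>{1..I}. (norm (x n - y))\<^sup>2
        + 2 * lam * (f i y - f i (x n) + M2 * ((1 - \<alpha> i) * r i n)) + lam\<^sup>2 * M1)"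
    proof (intro mult_left_mono sum_mono)
      fix i assume i: "i \<in> {1..I}"
      obtain u where u: "u \<in> subdifferential (f i) (x n)" using sub_ne[OF i] by blast
      have "lam\<^sup>2 * (norm (g i n))\<^sup>2 \<le> lam\<^sup>2 * M1"
        using g_le[OF i] by (intro mult_left_mono) auto
      then show "(norm (w i n - lam *\<^sub>R g i n - y))\<^sup>2 \<le> (norm (x n - y))\<^sup>2
        + 2 * lam * (f i y - f i (x n) + M2 * ((1 - \<alpha> i) * r i n)) + lam\<^sup>2 * M1"
        using objective_step[OF qfne[OF i] in_Fix[OF y i] _ _ _ sub[OF i, unfolded w_def] u sub_le[OF i u],
            of lam] a[OF i] assms(7)
        unfolding w_def r_def by linarith
    qed simp
    also have "\<dots> = (norm (x n - y))\<^sup>2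
       + 2 * lam / real I * (total_objective I f y + real I * M1 * lam / 2
           + M2 * (\<Sum>i\<in>{1..I}. (1 - \<alpha> i) * r i n) - total_objective I f (x n))"
    proof -
      have split: "(\<Sum>i\<in>{1..I}. (norm (x n - y))\<^sup>2
          + 2 * lam * (f i y - f i (x n) + M2 * ((1 - \<alpha> i) * r i n)) + lam\<^sup>2 * M1)
        = real I * (norm (x n - y))\<^sup>2
          + 2 * lam * (total_objective I f y - total_objective I f (x n)
              + M2 * (\<Sum>i\<in>{1..I}. (1 - \<alpha> i) * r i n)) + real I * (lam\<^sup>2 * M1)"
        unfolding total_objective_def
        by (simp add: sum.distrib sum_subtractf flip: sum_distrib_left)
      show ?thesis unfolding split using I by (simp add: field_simps power2_eq_square)
    qed
    finally show ?thesis .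
  qed

  have residual_bound:
    "liminf (\<lambda>n. ereal ((norm (x n - Q i (x n)))\<^sup>2))
       \<le> ereal (real I * L * lam / (\<alpha> i * (1 - \<alpha> i)))" if i: "i \<in> {1..I}" for i
  proof (rule liminf_le_of_bounded_increase)
    let ?b = "\<alpha> i * (1 - \<alpha> i)"
    have b: "0 < ?b" using a[OF i] by simp
    show "0 < 2 / real I * ?b" using b I by simp
    show "(norm (x (Suc n) - z))\<^sup>2 \<le> (norm (x n - z))\<^sup>2
        + 2 / real I * ?b * (real I * L * lam / ?b - (norm (x n - Q i (x n)))\<^sup>2)" for n
    proof -
      have "?b * (r i n)\<^sup>2 \<le> D n"
        unfolding D_def using a i
        by (intro member_le_sum) (auto intro!: mult_nonneg_nonneg simp: less_imp_le)
      moreover have "?b * (real I * L * lam / ?b) = real I * L * lam"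
        using b by (intro trans[OF times_divide_eq_right nonzero_mult_div_cancel_left]) auto
      ultimately have "real I * L * lam - D n \<le> ?b * (real I * L * lam / ?b - (r i n)\<^sup>2)"
        unfolding right_diff_distrib by linarith
      then have "2 / real I * (real I * L * lam - D n)
          \<le> 2 / real I * (?b * (real I * L * lam / ?b - (r i n)\<^sup>2))"
        using I by (intro mult_left_mono) auto
      then show ?thesis
        using residual_decrease[of n] unfolding r_def mult.assoc by linarith
    qed
  qed simp

  obtain y where y: "y \<in> constraint_set I Q"
    and y_opt: "optimal_value I f Q = ereal (total_objective I f y)"
    using assms(6) by (auto simp: solution_set_def)
  define T where "T S = (\<Sum>i\<in>{1..I}. sqrt ((1 - \<alpha> i) * S / \<alpha> i))" for S
  define c where "c S = total_objective I f y + real I * M1 * lam / 2 + M2 * T S" for S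

  \<comment> \<open>A level \<open>S\<close> strictly above \<open>I * L * lam\<close> is positive even if \<open>L = 0\<close>, so division by \<open>S\<close> is
    meaningful; the bound at \<open>I * L * lam\<close> itself follows by continuity of \<open>c\<close>.\<close>
  have objective_bound: "liminf (\<lambda>n. ereal (total_objective I f (x n))) \<le> ereal (c S)"
    if S: "real I * L * lam < S" for S
  proof -
    have S_pos: "0 < S" using S L_nonneg I assms(7)
      by (smt (verit) mult_nonneg_nonneg)
    have T_nonneg: "0 \<le> T S"
      unfolding T_def using a S_pos by (intro sum_nonneg) (auto simp: less_imp_le)
    \<comment> \<open>The weight \<open>\<theta>\<close> is the one for which the terms in \<open>D n\<close> of the two decrease inequalities
      cancel.\<close>
    define \<theta> where "\<theta> = lam * M2 * T S / (2 * S)"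
    have \<theta>: "0 \<le> \<theta>" using assms(7) M2_nonneg T_nonneg S_pos by (simp add: \<theta>_def)
    have disp: "(\<Sum>i\<in>{1..I}. (1 - \<alpha> i) * r i n) \<le> T S * (1 + D n / S) / 2" for n
    proof -
      have "(1 - \<alpha> i) * r i n \<le> sqrt ((1 - \<alpha> i) * S / \<alpha> i) * (1 + D n / S) / 2"
        if i: "i \<in> {1..I}" for i
      proof -
        have "\<alpha> i * (1 - \<alpha> i) * (r i n)\<^sup>2 \<le> D n"
          unfolding D_def using a i
          by (intro member_le_sum) (auto intro!: mult_nonneg_nonneg simp: less_imp_le)
        then have "sqrt ((1 - \<alpha> i) * S / \<alpha> i) * (1 + \<alpha> i * (1 - \<alpha> i) * (r i n)\<^sup>2 / S) / 2
            \<le> sqrt ((1 - \<alpha> i) * S / \<alpha> i) * (1 + D n / S) / 2"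
          using a[OF i] S_pos
          by (intro divide_right_mono mult_left_mono add_left_mono) auto
        then show ?thesis
          using displacement_le_weighted_residual[of "\<alpha> i" S "r i n"] a[OF i] S_pos by linarith
      qed
      then have "(\<Sum>i\<in>{1..I}. (1 - \<alpha> i) * r i n)
          \<le> (\<Sum>i\<in>{1..I}. sqrt ((1 - \<alpha> i) * S / \<alpha> i) * (1 + D n / S) / 2)"
        by (rule sum_mono)
      also have "\<dots> = T S * (1 + D n / S) / 2"
        by (simp add: T_def sum_distrib_right sum_divide_distrib)
      finally show ?thesis .
    qed
    show ?thesis
    proof (rule liminf_le_of_bounded_increase)
      let ?V = "\<lambda>n. (norm (x n - y))\<^sup>2 + \<theta> * (norm (x n - z))\<^sup>2"
      show "0 \<le> ?V n" for n using \<theta> by simp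
      show "0 < 2 * lam / real I" using I assms(7) by simp
      show "?V (Suc n) \<le> ?V n + 2 * lam / real I * (c S - total_objective I f (x n))" for n
      proof -
        let ?E = "\<Sum>i\<in>{1..I}. (1 - \<alpha> i) * r i n"
        have "M2 * ?E \<le> M2 * (T S * (1 + D n / S) / 2)"
          using disp M2_nonneg by (intro mult_left_mono)
        then have "2 * lam / real I * (M2 * ?E) \<le> 2 * lam / real I * (M2 * (T S * (1 + D n / S) / 2))"
          by (rule mult_left_mono) (use assms(7) I in simp)
        moreover have "\<theta> * (norm (x (Suc n) - z))\<^sup>2
            \<le> \<theta> * ((norm (x n - z))\<^sup>2 + 2 / real I * (S - D n))"
        proof (intro mult_left_mono[OF _ \<theta>] order_trans[OF residual_decrease] add_left_mono)
          show "2 / real I * (real I * L * lam - D n) \<le> 2 / real I * (S - D n)"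
            using S I by (intro mult_left_mono) auto
        qed
        moreover have "2 * lam / real I * (M2 * (T S * (1 + D n / S) / 2))
            + \<theta> * (2 / real I * (S - D n)) = 2 * lam / real I * (M2 * T S)"
          using S_pos I by (simp add: \<theta>_def field_simps)
        ultimately show ?thesis
          using objective_decrease[OF y, of n]
          unfolding c_def distrib_left right_diff_distrib by linarith
      qed
    qed
  qed

  define S0 where "S0 = real I * L * lam"
  have "liminf (\<lambda>n. ereal (total_objective I f (x n))) \<le> ereal (c S0)"
  proof (rule tendsto_lowerbound)
    have "(c \<longlongrightarrow> c S0) (at_right S0)"
      unfolding c_def T_def divide_inverse by (intro tendsto_intros)
    then show "((\<lambda>S. ereal (c S)) \<longlongrightarrow> ereal (c S0)) (at_right S0)" by simp
    show "\<forall>\<^sub>F S in at_right S0. liminf (\<lambda>n. ereal (total_objective I f (x n))) \<le> ereal (c S)"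
      using eventually_at_right_less by eventually_elim (simp add: objective_bound S0_def)
  qed simp
  also have "c S0 \<le> total_objective I f y + (real I * M1 * lam + (sqrt M1 + M2) * T S0)"
  proof -
    have "0 \<le> T S0"
      unfolding T_def S0_def using a L_nonneg assms(7)
      by (intro sum_nonneg) (auto simp: less_imp_le intro!: mult_nonneg_nonneg divide_nonneg_pos)
    then have "0 \<le> sqrt M1 * T S0" using M1_nonneg by simp
    moreover have "0 \<le> real I * M1 * lam" using M1_nonneg assms(7) by simp
    ultimately show ?thesis unfolding c_def distrib_right by linarith
  qed
  finally have "liminf (\<lambda>n. ereal (total_objective I f (x n)))
      \<le> optimal_value I f Q + ereal (real I * M1 * lam + (sqrt M1 + M2) * T S0)"
    by (simp add: y_opt)
  then show ?thesis
    using residual_bound False by (simp add: L_def T_def S0_def mult.assoc)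
qed

end
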